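(* For all partitions $\lambda$, $$\prod_{c \in \lambda} h_c^{\mathrm{op}} \geq \prod_{c \in \lambda} h_c.$$ Moreover, equality holds if and only if $\lambda$ is a rectangle.
   Context: A partition $\lambda = (\lambda_1 \geq \cdots \geq \lambda_m \geq 0)$ is identified with its set of cells $\{(a,b) \in \mathbb{Z}\times\mathbb{Z} : 1 \leq b \leq m,\ 1 \leq a \leq \lambda_b\}$. With $\lambda'$ the conjugate partition, the hook length of a cell $c=(a,b) \in \lambda$ is $h_c = (\lambda_b - a) + (\lambda_a' - b) + 1$, and the opposite hook length of $c = (a,b)$ is $h_c^{\mathrm{op}} = a + b - 1$. A partition is a rectangle if all its nonzero parts are equal. *)

theory Defs
  imports Main
begin

text \<open>
  A partition is a weakly decreasing list of naturals; trailing zero parts are allowed.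
  Parts are indexed from 1, and \<open>part\<close> is 0 beyond the end of the list.
\<close>

definition is_partition :: "nat list \<Rightarrow> bool" where
  "is_partition l \<longleftrightarrow> sorted_wrt (\<ge>) l"

definition part :: "nat list \<Rightarrow> nat \<Rightarrow> nat" where
  "part l i = (if 1 \<le> i \<and> i \<le> length l then l ! (i - 1) else 0)"

text \<open>
  All cells have positive coordinates, so they are represented as pairs of naturals;
  the second coordinate is the row index.
\<close>

definition cells :: "nat list \<Rightarrow> (nat \<times> nat) set" where
  "cells l = {(a, b). 1 \<le> b \<and> b \<le> length l \<and> 1 \<le> a \<and> a \<le> part l b}"

definition conjugate :: "nat list \<Rightarrow> nat list" where
  "conjugate l = map (\<lambda>a. card {b. 1 \<le> b \<and> b \<le> length l \<and> a \<le> part l b}) [1..<part l 1 + 1]"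

text \<open>
  The subtractions on naturals do not truncate when \<open>(a, b)\<close> is a cell of a partition:
  see \<open>cell_le_part\<close> below.
\<close>

definition hook_length :: "nat list \<Rightarrow> nat \<times> nat \<Rightarrow> nat" where
  "hook_length l = (\<lambda>(a, b). (part l b - a) + (part (conjugate l) a - b) + 1)"

definition op_hook_length :: "nat \<times> nat \<Rightarrow> nat" where
  "op_hook_length = (\<lambda>(a, b). a + b - 1)"

definition is_rectangle :: "nat list \<Rightarrow> bool" where
  "is_rectangle l \<longleftrightarrow> (\<forall>p \<in> set l. \<forall>q \<in> set l. p \<noteq> 0 \<longrightarrow> q \<noteq> 0 \<longrightarrow> p = q)"

lemma part_antimono:
  assumes "is_partition l" "1 \<le> i" "i \<le> j"
  shows "part l j \<le> part l i"
proof (cases "i = j \<or> length l < j")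
  case True
  then show ?thesis by (auto simp: part_def)
next
  case False
  with assms have "l ! (i - 1) \<ge> l ! (j - 1)"
    unfolding is_partition_def by (intro sorted_wrt_nth_less[where P = "(\<ge>)"]) auto
  with False assms show ?thesis by (auto simp: part_def)
qed

lemma finite_cells: "finite (cells l)"
proof (rule finite_subset)
  show "cells l \<subseteq> (\<Union>b\<in>{1..length l}. {1..part l b} \<times> {b})"
    by (auto simp: cells_def)
qed auto

lemma part_conjugate:
  assumes "is_partition l" "1 \<le> a"
  shows "part (conjugate l) a = card {b. 1 \<le> b \<and> b \<le> length l \<and> a \<le> part l b}"
proof (cases "a \<le> part l 1")
  case True
  with assms have "[1..<part l 1 + 1] ! (a - 1) = a" by (subst nth_upt) auto
  with True assms show ?thesis
    by (subst part_def) (simp add: conjugate_def del: upt_Suc)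
next
  case False
  have "\<not> a \<le> part l b" if "1 \<le> b" for b
    using part_antimono[OF assms(1), of 1 b] that False by simp
  then have "{b. 1 \<le> b \<and> b \<le> length l \<and> a \<le> part l b} = {}" by auto
  moreover have "part (conjugate l) a = 0"
    using False by (subst part_def) (simp add: conjugate_def del: upt_Suc)
  ultimately show ?thesis by simp
qed

lemma is_partition_conjugate: "is_partition (conjugate l)"
  unfolding is_partition_def conjugate_def sorted_wrt_map
  by (rule sorted_wrt_mono_rel[OF _ sorted_wrt_upt])
    (auto intro!: card_mono intro: finite_subset[of _ "{..length l}"])

lemma cell_conjugate_iff:
  assumes "is_partition l" "1 \<le> a" "1 \<le> b"
  shows "b \<le> part (conjugate l) a \<longleftrightarrow> a \<le> part l b"
proof -
  let ?S = "{b. 1 \<le> b \<and> b \<le> length l \<and> a \<le> part l b}"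
  have fin: "finite ?S" by (rule finite_subset[of _ "{..length l}"]) auto
  show ?thesis
  proof
    assume ab: "a \<le> part l b"
    have "{1..b} \<subseteq> ?S"
    proof
      fix c assume c: "c \<in> {1..b}"
      with part_antimono[OF assms(1), of c b] ab have "a \<le> part l c" by simp
      with c assms(2) show "c \<in> ?S" by (auto simp: part_def split: if_splits)
    qed
    from card_mono[OF fin this] show "b \<le> part (conjugate l) a"
      by (simp add: part_conjugate[OF assms(1,2)])
  next
    assume le: "b \<le> part (conjugate l) a"
    show "a \<le> part l b"
    proof (rule ccontr)
      assume n: "\<not> a \<le> part l b"
      have "?S \<subseteq> {1..<b}"
      proof
        fix c assume c: "c \<in> ?S"
        show "c \<in> {1..<b}"
          using part_antimono[OF assms(1,3), of c] c n by (cases "b \<le> c") auto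
      qed
      from card_mono[OF _ this] have "card ?S \<le> b - 1" by simp
      with le assms(3) show False by (simp add: part_conjugate[OF assms(1,2)])
    qed
  qed
qed

lemma cell_le_part:
  assumes "is_partition l" "(a, b) \<in> cells l"
  shows "a \<le> part l b" and "b \<le> part (conjugate l) a"
  using assms cell_conjugate_iff[of l a b] by (auto simp: cells_def)

lemma cells_conjugate:
  assumes "is_partition l"
  shows "(b, a) \<in> cells (conjugate l) \<longleftrightarrow> (a, b) \<in> cells l"
proof -
  have "(x, y) \<in> cells m \<longleftrightarrow> 1 \<le> y \<and> 1 \<le> x \<and> x \<le> part m y" for x y m
    by (auto simp: cells_def part_def split: if_splits)
  then show ?thesis using cell_conjugate_iff[OF assms, of a b] by auto
qed

end

theory Submission
  imports Defs
begin

text \<open>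
  The proof removes the first row \<open>p\<close> of the partition \<open>p # l\<close>. Hooks below the first row are
  unchanged, so the hook product drops by the product \<open>R\<close> of the first-row hooks, whereas every
  remaining cell moves up by one row, which changes the opposite hooks.

  With \<open>n\<close> the length of \<open>l\<close> and \<open>x\<^sub>1, \<dots>, x\<^sub>n\<close> its parts, both changes have closed forms.
  The first-row hooks and the numbers \<open>p - x\<^sub>b + b\<close> together make up \<open>{1..p + n}\<close> (the
  description of hooks by beta-numbers), so \<open>R * (\<Prod>b. p - x\<^sub>b + b) = (p + n)!\<close>
  (\<open>first_row_hook_prod\<close>). The opposite hooks telescope along rows, so their product
  changes by the factor \<open>p! * (\<Prod>b. (x\<^sub>b + b) / b)\<close> (\<open>shifted_op_prod\<close>). After clearing
  denominators and cancelling \<open>p!\<close>, the claim that the opposite product grows by at least \<open>R\<close>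
  becomes a product over \<open>b\<close> of the inequalities
  \<open>(p + b) * b \<le> (x\<^sub>b + b) * (p - x\<^sub>b + b)\<close>, whose two sides differ by
  \<open>x\<^sub>b * (p - x\<^sub>b)\<close>. Equality therefore means that every \<open>x\<^sub>b\<close> is \<open>0\<close> or \<open>p\<close>,
  and requiring this for each removed row characterises rectangles.
\<close>

section \<open>Removing the first row\<close>

lemma part_Cons_1: "part (p # l) (Suc 0) = p"
  by (simp add: part_def)

lemma part_Cons_Suc: "1 \<le> b \<Longrightarrow> part (p # l) (Suc b) = part l b"
  by (auto simp: part_def)

lemma part_le_head:
  assumes "is_partition (p # l)"
  shows "part l b \<le> p"
  using assms by (auto simp: part_def is_partition_def)

lemma prod_cells_Cons:
  fixes f :: "nat \<times> nat \<Rightarrow> nat"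
  shows "(\<Prod>c\<in>cells (p # l). f c) =
    (\<Prod>a\<in>{1..p}. f (a, 1)) * (\<Prod>(a, b)\<in>cells l. f (a, Suc b))"
proof -
  let ?row = "(\<lambda>a. (a, 1::nat)) ` {1..p}" and ?low = "(\<lambda>(a, b). (a, Suc b)) ` cells l"
  have "cells (p # l) = ?row \<union> ?low"
  proof (intro set_eqI)
    fix c :: "nat \<times> nat"
    obtain a b where c: "c = (a, b)" by (cases c)
    consider "b = 0" | "b = 1" | k where "b = Suc k" "1 \<le> k"
      by (cases b) (auto simp: Suc_le_eq)
    then show "c \<in> cells (p # l) \<longleftrightarrow> c \<in> ?row \<union> ?low"
      by cases (auto simp: c cells_def part_Cons_1 part_Cons_Suc image_iff)
  qed
  moreover have "?row \<inter> ?low = {}"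
    by (auto simp: cells_def)
  ultimately have "(\<Prod>c\<in>cells (p # l). f c) = prod f ?row * prod f ?low"
    by (simp add: prod.union_disjoint finite_cells)
  also have "prod f ?row = (\<Prod>a\<in>{1..p}. f (a, 1))"
    by (subst prod.reindex) (auto simp: inj_on_def)
  also have "prod f ?low = (\<Prod>(a, b)\<in>cells l. f (a, Suc b))"
    by (subst prod.reindex) (auto simp: inj_on_def intro!: prod.cong)
  finally show ?thesis .
qed

lemma part_conjugate_Cons:
  assumes "is_partition (p # l)" "1 \<le> a" "a \<le> p"
  shows "part (conjugate (p # l)) a = Suc (part (conjugate l) a)"
proof -
  have l: "is_partition l" using assms(1) by (simp add: is_partition_def)
  let ?S = "{b. 1 \<le> b \<and> b \<le> length l \<and> a \<le> part l b}"
  have "{b. 1 \<le> b \<and> b \<le> length (p # l) \<and> a \<le> part (p # l) b} = insert 1 (Suc ` ?S)"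
    (is "?T = _")
  proof (intro set_eqI)
    fix b
    consider "b = 0" | "b = 1" | k where "b = Suc k" "1 \<le> k"
      by (cases b) (auto simp: Suc_le_eq)
    then show "b \<in> ?T \<longleftrightarrow> b \<in> insert 1 (Suc ` ?S)"
      using assms(3) by cases (auto simp: part_Cons_1 part_Cons_Suc)
  qed
  moreover have "finite ?S" by (rule finite_subset[of _ "{..length l}"]) auto
  moreover have "1 \<notin> Suc ` ?S" by auto
  ultimately show ?thesis
    by (simp add: part_conjugate[OF assms(1,2)] part_conjugate[OF l assms(2)] card_image)
qed

lemma hook_length_Cons_Suc:
  assumes "is_partition (p # l)" "(a, b) \<in> cells l"
  shows "hook_length (p # l) (a, Suc b) = hook_length l (a, b)"
proof -
  have "1 \<le> a" "1 \<le> b" "a \<le> p"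
    using assms part_le_head[OF assms(1), of b] by (auto simp: cells_def)
  then show ?thesis
    by (simp add: hook_length_def part_conjugate_Cons[OF assms(1)] part_Cons_Suc)
qed

lemma hook_length_pos: "0 < hook_length l c"
  by (auto simp: hook_length_def split: prod.splits)

lemma hook_prod_Cons:
  assumes "is_partition (p # l)"
  shows "(\<Prod>c\<in>cells (p # l). hook_length (p # l) c) =
    (\<Prod>a\<in>{1..p}. hook_length (p # l) (a, 1)) * (\<Prod>c\<in>cells l. hook_length l c)"
  unfolding prod_cells_Cons
  by (intro arg_cong2[where f = "(*)"] refl prod.cong)
    (auto simp: hook_length_Cons_Suc[OF assms] split: prod.splits)

section \<open>Closed forms for the two changes\<close>

text \<open>
  The boundary of the diagram is a lattice path with \<open>p\<close> horizontal and \<open>n\<close> vertical steps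
  below the first row. Numbering the steps from the top right end, the hooks of the first row
  are the positions of the horizontal steps and the numbers \<open>p - x\<^sub>b + b\<close> those of the vertical ones, so the two
  families partition \<open>{1..p + n}\<close>. Both are injective by monotonicity; they are
  disjoint because \<open>a \<le> x\<^sub>b\<close> holds exactly when \<open>b\<close> is at most the length of
  column \<open>a\<close> of \<open>l\<close>.
\<close>

lemma first_row_hook_prod:
  assumes part: "is_partition (p # l)"
  shows "(\<Prod>a\<in>{1..p}. hook_length (p # l) (a, 1)) *
    (\<Prod>b\<in>{1..length l}. p - part l b + b) = \<Prod>{1..p + length l}"
proof -
  define n where "n = length l"
  have l: "is_partition l" using part by (simp add: is_partition_def)
  define h where "h a = p - a + part (conjugate l) a + 1" for a
  define v where "v b = p - part l b + b" for b
  have col_le: "part (conjugate l) a \<le> n" if "1 \<le> a" for a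
  proof -
    have "{b. 1 \<le> b \<and> b \<le> length l \<and> a \<le> part l b} \<subseteq> {1..n}" by (auto simp: n_def)
    from card_mono[OF _ this] show ?thesis by (simp add: part_conjugate[OF l that])
  qed
  have inj_h: "inj_on h {1..p}"
  proof (rule linorder_inj_onI)
    fix a a' assume "a < a'" "a \<in> {1..p}" "a' \<in> {1..p}"
    with part_antimono[OF is_partition_conjugate, of a a' l] show "h a \<noteq> h a'"
      by (auto simp: h_def)
  qed auto
  have inj_v: "inj_on v {1..n}"
  proof (rule linorder_inj_onI)
    fix b b' assume "b < b'" "b \<in> {1..n}" "b' \<in> {1..n}"
    with part_antimono[OF l, of b b'] part_le_head[OF part, of b] show "v b \<noteq> v b'"
      by (auto simp: v_def)
  qed auto
  have "h a \<noteq> v b" if "a \<in> {1..p}" "b \<in> {1..n}" for a b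
    using cell_conjugate_iff[OF l, of a b] part_le_head[OF part, of b] that
    by (cases "a \<le> part l b") (auto simp: h_def v_def)
  then have disj: "h ` {1..p} \<inter> v ` {1..n} = {}" by auto
  have "h ` {1..p} \<union> v ` {1..n} = {1..p + n}"
  proof (rule card_subset_eq)
    have "h a \<in> {1..p + n}" if "a \<in> {1..p}" for a
      using col_le[of a] that by (auto simp: h_def)
    moreover have "v b \<in> {1..p + n}" if "b \<in> {1..n}" for b
      using that by (auto simp: v_def)
    ultimately show "h ` {1..p} \<union> v ` {1..n} \<subseteq> {1..p + n}" by blast
    show "card (h ` {1..p} \<union> v ` {1..n}) = card {1..p + n}"
      using disj inj_h inj_v by (simp add: card_Un_disjoint card_image)
  qed simp
  then have "\<Prod>{1..p + n} = \<Prod>(h ` {1..p}) * \<Prod>(v ` {1..n})"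
    using disj by (metis finite_imageI finite_atLeastAtMost prod.union_disjoint)
  also have "\<dots> = prod h {1..p} * prod v {1..n}"
    using inj_h inj_v by (simp add: prod.reindex)
  also have "prod h {1..p} = (\<Prod>a\<in>{1..p}. hook_length (p # l) (a, 1))"
    by (intro prod.cong refl)
      (auto simp: h_def hook_length_def part_Cons_1 part_conjugate_Cons[OF part])
  finally show ?thesis by (simp add: n_def v_def)
qed

lemma prod_cells_rows:
  fixes f :: "nat \<times> nat \<Rightarrow> nat"
  shows "(\<Prod>c\<in>cells l. f c) = (\<Prod>b\<in>{1..length l}. \<Prod>a\<in>{1..part l b}. f (a, b))"
proof -
  have "(\<Prod>b\<in>{1..length l}. \<Prod>a\<in>{1..part l b}. f (a, b)) =
      (\<Prod>(b, a)\<in>(SIGMA b:{1..length l}. {1..part l b}). f (a, b))"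
    by (subst prod.Sigma) auto
  also have "\<dots> = (\<Prod>c\<in>cells l. f c)"
    by (rule prod.reindex_bij_witness[of _ prod.swap prod.swap]) (auto simp: cells_def)
  finally show ?thesis by simp
qed

text \<open>
  Moving row \<open>b\<close> down by one replaces its opposite hooks \<open>b, \<dots>, x + b - 1\<close> by
  \<open>b + 1, \<dots>, x + b\<close>: the factor \<open>b\<close> is traded for \<open>x + b\<close>.
\<close>

lemma shifted_op_prod:
  "(\<Prod>(a, b)\<in>cells l. op_hook_length (a, Suc b)) * \<Prod>{1..length l} =
    (\<Prod>c\<in>cells l. op_hook_length c) * (\<Prod>b\<in>{1..length l}. part l b + b)"
proof -
  have row: "(\<Prod>a\<in>{1..x}. a + b) * b = (\<Prod>a\<in>{1..x}. a + b - 1) * (x + b)" for x b :: nat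
  proof (induction x)
    case (Suc x)
    have "(\<Prod>a\<in>{1..Suc x}. a + b) * b = ((\<Prod>a\<in>{1..x}. a + b) * b) * (Suc x + b)"
      by (simp add: mult_ac)
    also have "\<dots> = (\<Prod>a\<in>{1..Suc x}. a + b - 1) * (Suc x + b)"
      unfolding Suc.IH by simp
    finally show ?case .
  qed simp
  have "(\<Prod>(a, b)\<in>cells l. op_hook_length (a, Suc b)) * \<Prod>{1..length l} =
      (\<Prod>b\<in>{1..length l}. (\<Prod>a\<in>{1..part l b}. a + b) * b)"
    by (simp add: prod_cells_rows op_hook_length_def prod.distrib)
  also have "\<dots> = (\<Prod>b\<in>{1..length l}. (\<Prod>a\<in>{1..part l b}. a + b - 1) * (part l b + b))"
    by (simp only: row)
  also have "\<dots> = (\<Prod>c\<in>cells l. op_hook_length c) * (\<Prod>b\<in>{1..length l}. part l b + b)"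
    by (simp add: prod_cells_rows op_hook_length_def prod.distrib)
  finally show ?thesis .
qed

lemma op_prod_pos: "0 < (\<Prod>c\<in>cells l. op_hook_length c)"
  by (intro prod_pos) (auto simp: cells_def op_hook_length_def)

section \<open>Comparing the two changes\<close>

lemma prod_mono_eq_iff:
  fixes f g :: "'a \<Rightarrow> nat"
  assumes "finite A" "\<And>x. x \<in> A \<Longrightarrow> f x \<le> g x" "\<And>x. x \<in> A \<Longrightarrow> 0 < f x"
  shows "prod f A = prod g A \<longleftrightarrow> (\<forall>x\<in>A. f x = g x)"
  using assms
proof (induction A)
  case (insert x A)
  have le: "f x \<le> g x" "prod f A \<le> prod g A" and pos: "0 < f x" "0 < prod f A"
    using insert by (auto intro!: prod_mono prod_pos)
  have "f x * prod f A = g x * prod g A \<longleftrightarrow> f x = g x \<and> prod f A = prod g A"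
  proof
    assume eq: "f x * prod f A = g x * prod g A"
    have "f x * prod f A \<le> g x * prod f A" "g x * prod f A \<le> g x * prod g A"
      using le by (auto intro: mult_le_mono)
    with eq le pos show "f x = g x \<and> prod f A = prod g A" by auto
  qed simp
  then show ?case using insert by simp
qed simp

lemma mult_defect:
  fixes x p b :: nat
  assumes "x \<le> p"
  shows "(x + b) * (p - x + b) = (p + b) * b + x * (p - x)"
proof -
  obtain y where "p = x + y" using assms le_Suc_ex by blast
  then show ?thesis by (simp add: algebra_simps)
qed

text \<open>
  The heart of the induction: the opposite product grows by at least the product \<open>R\<close> of the
  first-row hooks, because \<open>mult_defect\<close> makes the closed forms comparable factor by factor.
\<close>

lemma op_prod_Cons:
  assumes part: "is_partition (p # l)"
  defines "R \<equiv> \<Prod>a\<in>{1..p}. hook_length (p # l) (a, 1)"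
  shows "R * (\<Prod>c\<in>cells l. op_hook_length c) \<le> (\<Prod>c\<in>cells (p # l). op_hook_length c)"
    and "(\<Prod>c\<in>cells (p # l). op_hook_length c) = R * (\<Prod>c\<in>cells l. op_hook_length c) \<longleftrightarrow>
      (\<forall>x\<in>set l. x = 0 \<or> x = p)"
proof -
  define n where "n = length l"
  let ?op = "\<Prod>c\<in>cells l. op_hook_length c"
  let ?op' = "\<Prod>c\<in>cells (p # l). op_hook_length c"
  let ?D = "\<Prod>b\<in>{1..n}. p - part l b + b"
  define f where "f b = (p + b) * b" for b
  define g where "g b = (part l b + b) * (p - part l b + b)" for b
  have g_eq: "g b = f b + part l b * (p - part l b)" for b
    unfolding f_def g_def by (rule mult_defect[OF part_le_head[OF part]])
  \<comment> \<open>Both sides are compared after multiplication by \<open>M\<close>, which clears the denominators of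
    the two closed forms.\<close>
  define M where "M = \<Prod>{1..n} * ?D"
  have M: "0 < M" unfolding M_def by (auto intro!: prod_pos)
  have split: "\<Prod>{1..p + n} = \<Prod>{1..p} * (\<Prod>b\<in>{1..n}. p + b)" for n
    by (induction n) (simp_all add: algebra_simps)
  have "R * ?op * M = ?op * \<Prod>{1..n} * (R * ?D)"
    by (simp add: M_def mult_ac)
  also have "R * ?D = \<Prod>{1..p} * (\<Prod>b\<in>{1..n}. p + b)"
    unfolding R_def n_def first_row_hook_prod[OF part] split ..
  finally have hooks: "R * ?op * M = ?op * \<Prod>{1..p} * prod f {1..n}"
    by (simp add: f_def prod.distrib mult_ac)
  have "?op' = \<Prod>{1..p} * (\<Prod>(a, b)\<in>cells l. op_hook_length (a, Suc b))"
    unfolding prod_cells_Cons by (simp add: op_hook_length_def)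
  then have "?op' * M =
      \<Prod>{1..p} * ((\<Prod>(a, b)\<in>cells l. op_hook_length (a, Suc b)) * \<Prod>{1..n}) * ?D"
    by (simp add: M_def mult_ac)
  then have ops: "?op' * M = ?op * \<Prod>{1..p} * prod g {1..n}"
    unfolding n_def shifted_op_prod by (simp add: g_def prod.distrib mult_ac)
  have "prod f {1..n} \<le> prod g {1..n}"
    by (intro prod_mono) (simp add: g_eq)
  then have "R * ?op * M \<le> ?op' * M"
    unfolding hooks ops by (rule mult_le_mono2)
  then show "R * ?op \<le> ?op'" using M by simp
  have "0 < ?op * \<Prod>{1..p}"
    using op_prod_pos by (auto intro!: prod_pos)
  then have "?op' * M = R * ?op * M \<longleftrightarrow> prod f {1..n} = prod g {1..n}"
    unfolding hooks ops by auto
  also have "\<dots> \<longleftrightarrow> (\<forall>b\<in>{1..n}. f b = g b)"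
    by (rule prod_mono_eq_iff) (auto simp: g_eq, auto simp: f_def)
  also have "\<dots> \<longleftrightarrow> (\<forall>b\<in>{1..n}. part l b = 0 \<or> part l b = p)"
    using part_le_head[OF part] by (auto simp: g_eq le_antisym)
  also have "\<dots> \<longleftrightarrow> (\<forall>x\<in>part l ` {1..n}. x = 0 \<or> x = p)"
    by simp
  also have "part l ` {1..n} = set l"
  proof -
    have "part l ` {1..n} = (\<lambda>i. part l (Suc i)) ` {..<n}"
      unfolding image_Suc_lessThan[symmetric] image_image ..
    also have "\<dots> = (!) l ` {..<n}"
      by (intro image_cong) (auto simp: part_def n_def)
    finally show ?thesis by (auto simp: n_def set_conv_nth)
  qed
  finally show "?op' = R * ?op \<longleftrightarrow> (\<forall>x\<in>set l. x = 0 \<or> x = p)"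
    using M by simp
qed

lemma is_rectangle_Cons:
  assumes "is_partition (p # l)"
  shows "is_rectangle (p # l) \<longleftrightarrow> is_rectangle l \<and> (\<forall>x\<in>set l. x = 0 \<or> x = p)"
proof (cases "p = 0")
  case True
  with assms show ?thesis by (auto simp: is_rectangle_def is_partition_def)
next
  case False
  then show ?thesis by (auto simp: is_rectangle_def)
qed

section \<open>Hooks against opposite hooks\<close>

theorem proposition1:
  fixes l :: "nat list"
  assumes "is_partition l"
  shows "(\<Prod>c\<in>cells l. op_hook_length c) \<ge> (\<Prod>c\<in>cells l. hook_length l c) \<and>
    ((\<Prod>c\<in>cells l. op_hook_length c) = (\<Prod>c\<in>cells l. hook_length l c) \<longleftrightarrow> is_rectangle l)"
  using assms
proof (induction l)
  case Nil
  have "cells [] = {}" by (auto simp: cells_def)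
  then show ?case by (simp add: is_rectangle_def)
next
  case (Cons p l)
  let ?R = "\<Prod>a\<in>{1..p}. hook_length (p # l) (a, 1)"
  let ?op = "\<Prod>c\<in>cells l. op_hook_length c" and ?hook = "\<Prod>c\<in>cells l. hook_length l c"
  let ?op' = "\<Prod>c\<in>cells (p # l). op_hook_length c"
  have R: "0 < ?R" by (intro prod_pos) (simp add: hook_length_pos)
  have IH: "?hook \<le> ?op" "?op = ?hook \<longleftrightarrow> is_rectangle l"
    using Cons by (auto simp: is_partition_def)
  from IH(1) have le: "?R * ?hook \<le> ?R * ?op" by (rule mult_le_mono2)
  note step = op_prod_Cons[OF Cons.prems]
  have "?op' = ?R * ?hook \<longleftrightarrow> ?op' = ?R * ?op \<and> ?R * ?op = ?R * ?hook"
    using le step(1) by linarith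
  also have "\<dots> \<longleftrightarrow> is_rectangle (p # l)"
    unfolding step(2) is_rectangle_Cons[OF Cons.prems] IH(2)[symmetric] using R by auto
  finally show ?case
    unfolding hook_prod_Cons[OF Cons.prems] using le step(1) by linarith
qed

end
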